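(* Let $n\ge 2$ be an integer and let $p\in(1,\infty)$ with $p>n-1$. Then the probability density of the unique positive $L_p$-norm spherical copula in dimension $n$ is given by $$c^+(x)=\frac{1}{\Gamma\left(1+\frac1p\right)^{n-1}\,\Gamma\left(1-\frac{n-1}{p}\right)}\,\left(1-\|x\|_p^p\right)^{-(n-1)/p},\qquad x\in[0,\infty)^n,\ \|x\|_p<1$$ (and $c^+(x)=0$ for all other $x\in\mathbb{R}^n$).
   Context: For $p\in[1,\infty)$ and $x\in\mathbb{R}^n$ put $\|x\|_p=(\sum_{i=1}^n|x_i|^p)^{1/p}$. If a random vector $Z$ in $\mathbb{R}^n$ has a density of the form $g(\|x\|_p)$, then $\|Z\|_p$ and $Z/\|Z\|_p$ are independent and the law of $Z/\|Z\|_p$ does not depend on $g$ (one may take, for instance, $Z$ uniformly distributed on the unit ball $\{\|x\|_p<1\}$); this law is called the $L_p$-uniform distribution on the sphere, and $U_n$ denotes a random vector with this law. Let $U_n^+$ be the vector of componentwise absolute values of $U_n$. A random vector has an $L_p$-norm spherical distribution on $\mathbb{R}_+^n=[0,\infty)^n$ if it has the same law as $R\cdot U_n^+$, with $R\ge0$ a real random variable independent of $U_n^+$. A copula is a probability distribution on $[0,1]^n$ all of whose univariate marginals are uniform on $(0,1)$. A copula is called a positive $L_p$-norm spherical copula if it is an $L_p$-norm spherical distribution on $\mathbb{R}_+^n$. For $p\ge n-1$ exactly one such copula exists. *)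

theory Defs
  imports "HOL-Probability.Probability"
begin

definition Lp_norm :: "real \<Rightarrow> real ^ 'n \<Rightarrow> real" where
  "Lp_norm p x = (\<Sum>i\<in>UNIV. \<bar>x $ i\<bar> powr p) powr (1 / p)"

text \<open>The law of \<open>U\<^sub>n = Z / \<parallel>Z\<parallel>\<^sub>p\<close> for \<open>Z\<close> uniformly distributed on the open unit ball of the
  \<open>p\<close>-norm.  Any other \<open>Z\<close> with a density \<open>g (\<parallel>x\<parallel>\<^sub>p)\<close> gives the same law.\<close>

definition Lp_uniform :: "real \<Rightarrow> (real ^ 'n) measure" where
  "Lp_uniform p =
     distr (uniform_measure lborel {z. Lp_norm p z < 1}) borel (\<lambda>z. z /\<^sub>R Lp_norm p z)"

definition Lp_uniform_pos :: "real \<Rightarrow> (real ^ 'n) measure" where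
  "Lp_uniform_pos p = distr (Lp_uniform p) borel (\<lambda>u. \<chi> i. \<bar>u $ i\<bar>)"

text \<open>Here \<open>\<rho>\<close> is the law of the radial variable \<open>R \<ge> 0\<close>.  That \<open>R\<close> and \<open>U\<^sub>n\<^sup>+\<close> are independent
  means that their joint law is the product measure.\<close>

definition positive_Lp_spherical :: "real \<Rightarrow> (real ^ 'n) measure \<Rightarrow> bool" where
  "positive_Lp_spherical p M \<longleftrightarrow>
     (\<exists>\<rho> :: real measure. prob_space \<rho> \<and> sets \<rho> = sets borel \<and> (AE r in \<rho>. 0 \<le> r) \<and>
        M = distr (\<rho> \<Otimes>\<^sub>M Lp_uniform_pos p) borel (\<lambda>(r, u). r *\<^sub>R u))"

text \<open>Distributions on \<open>[0,1]\<^sup>n\<close> are Borel measures on all of \<open>\<real>\<^sup>n\<close> concentrated on the cube.\<close>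

definition copula :: "(real ^ 'n) measure \<Rightarrow> bool" where
  "copula C \<longleftrightarrow>
     prob_space C \<and> sets C = sets borel \<and> (AE x in C. \<forall>i. x $ i \<in> {0..1}) \<and>
     (\<forall>i. distr C borel (\<lambda>x. x $ i) = uniform_measure lborel {0<..<1})"

definition positive_Lp_spherical_copula :: "real \<Rightarrow> (real ^ 'n) measure \<Rightarrow> bool" where
  "positive_Lp_spherical_copula p C \<longleftrightarrow> copula C \<and> positive_Lp_spherical p C"

end

(* Let X = R U with U = U_n^+. Uniqueness: coordinates of X are uniform, so for every k
   E[R^k] E[U_i^k] = 1/(k+1), and R = ||X||_p is bounded; hence all moments of R, and with them
   its law, are determined.

   Existence: under polar decomposition x = ||x||_p u Lebesgue measure is the product of the law of
   the radius and of U_n, so the claimed density is radial with some law of R. Again by boundedness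
   it suffices to check that E[X_i^k] = 1/(k+1). The factor E[U_i^k] is found by integrating
   |x_i|^k exp(-||x||_p^p), which splits into one-dimensional Gamma integrals, and the radial factor
   is a Beta integral.

   No change of variables is needed: the image of Lebesgue measure under t = ||x||_p^p has
   distribution function W a^(n/p) by scaling, W being the volume of the unit ball, and therefore
   density W (n/p) t^(n/p - 1). *)
theory Submission
  imports Defs
begin

section \<open>Lebesgue measure on coordinates and orthants\<close>

lemma nn_integral_lborel_cart_prod:
  fixes f :: "'n::finite \<Rightarrow> real \<Rightarrow> ennreal"
  assumes [measurable]: "\<And>i. f i \<in> borel_measurable borel"
  shows "(\<integral>\<^sup>+x. (\<Prod>i\<in>UNIV. f i (x $ i)) \<partial>(lborel :: (real ^ 'n) measure)) =
    (\<Prod>i\<in>UNIV. \<integral>\<^sup>+t. f i t \<partial>lborel)"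
proof -
  have Basis: "(Basis :: (real ^ 'n) set) = range (\<lambda>i. axis i 1)"
    by (auto simp: Basis_vec_def)
  have inj: "inj (\<lambda>i::'n. axis i (1::real))"
    by (auto simp: inj_def axis_eq_axis)
  \<comment> \<open>The library formula is indexed by basis vectors, the family \<open>f\<close> by
    coordinates. \<open>h\<close> relabels \<open>f\<close> along the injection that sends i to
    \<open>axis i 1\<close>.\<close>
  define h where "h b = f (inv (\<lambda>i::'n. axis i (1::real)) b)" for b
  have h: "h (axis i 1) = f i" for i
    by (simp add: h_def inv_f_f[OF inj])
  have "(\<integral>\<^sup>+x. (\<Prod>b\<in>Basis. h b (x \<bullet> b)) \<partial>(lborel :: (real ^ 'n) measure)) =
      (\<Prod>b\<in>Basis. \<integral>\<^sup>+t. h b t \<partial>lborel)"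
    by (rule nn_integral_lborel_prod) (auto simp: h_def)
  then show ?thesis
    by (simp add: Basis prod.reindex[OF inj] h flip: cart_eq_inner_axis)
qed

lemma nn_integral_lborel_abs:
  fixes f :: "real \<Rightarrow> ennreal"
  assumes [measurable]: "f \<in> borel_measurable borel"
  shows "(\<integral>\<^sup>+t. f \<bar>t\<bar> \<partial>lborel) = 2 * (\<integral>\<^sup>+t. f t * indicator {0..} t \<partial>lborel)"
proof -
  \<comment> \<open>Split the line at 0. The point 0 lies in both closed half-lines and is counted
    twice, so the integrands agree only almost everywhere.\<close>
  have "(\<integral>\<^sup>+t. f \<bar>t\<bar> \<partial>lborel) =
      (\<integral>\<^sup>+t. f t * indicator {0..} t + f (- t) * indicator {0..} (- t) \<partial>lborel)"
    by (intro nn_integral_cong_AE, use AE_lborel_singleton[of "0::real"] in eventually_elim)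
       (auto simp: indicator_def abs_if)
  also have "\<dots> = (\<integral>\<^sup>+t. f t * indicator {0..} t \<partial>lborel) +
      (\<integral>\<^sup>+t. f (- t) * indicator {0..} (- t) \<partial>lborel)"
    by (rule nn_integral_add) auto
  also have "(\<integral>\<^sup>+t. f (- t) * indicator {0..} (- t) \<partial>lborel) =
      (\<integral>\<^sup>+t. f t * indicator {0..} t \<partial>lborel)"
    using nn_integral_real_affine[of "\<lambda>t. f t * indicator {0..} t" "- 1" 0] by simp
  finally show ?thesis
    by (simp add: mult_2)
qed

text \<open>Each of the 2^n orthants is reflected onto the positive one, which therefore carries 2^n
  times Lebesgue measure. Boxes generate the Borel sets, and on a box both sides factor into
  one-dimensional integrals.\<close>

lemma distr_lborel_cart_abs:
  "distr (lborel :: (real ^ 'n::finite) measure) borel (\<lambda>x. \<chi> i. \<bar>x $ i\<bar>) =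
    density lborel (\<lambda>x. 2 ^ CARD('n) * indicator {x. \<forall>i. 0 \<le> x $ i} x)"
    (is "?M = density lborel ?d")
proof (rule measure_eqI_generator_eq)
  let ?E = "range (\<lambda>(a, b). box a b :: (real ^ 'n) set)"
  have abs_m [measurable]: "(\<lambda>x::real ^ 'n. \<chi> i. \<bar>x $ i\<bar>) \<in> borel_measurable borel"
    by (intro borel_measurable_continuous_onI continuous_intros)
  have orth_m [measurable]: "{x::real ^ 'n. \<forall>i. 0 \<le> x $ i} \<in> sets borel"
    by measurable
  show "Int_stable ?E"
    by (auto simp: Int_stable_def box_Int_box)
  show "?E \<subseteq> Pow UNIV" "sets ?M = sigma_sets UNIV ?E" "sets (density lborel ?d) = sigma_sets UNIV ?E"
    by (simp_all add: borel_eq_box)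
  let ?A = "\<lambda>n::nat. box (- (real n *\<^sub>R One)) (real n *\<^sub>R One) :: (real ^ 'n) set"
  show "range ?A \<subseteq> ?E" "(\<Union>i. ?A i) = UNIV"
    unfolding UN_box_eq_UNIV by auto
  show "emeasure ?M X = emeasure (density lborel ?d) X" if "X \<in> ?E" for X
  proof -
    obtain l u where X: "X = box l u" using \<open>X \<in> ?E\<close> by auto
    have ind: "indicator (box l u) x = (\<Prod>i\<in>UNIV. indicator {l $ i<..<u $ i} (x $ i) :: ennreal)"
      for x :: "real ^ 'n"
      by (auto simp: mem_box_cart indicator_def)
    have ind': "indicator {x. \<forall>i. 0 \<le> x $ i} x = (\<Prod>i\<in>UNIV. indicator {0..} (x $ i) :: ennreal)"
      for x :: "real ^ 'n"
      by (auto simp: indicator_def)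
    have "emeasure ?M X = (\<integral>\<^sup>+x. indicator (box l u) x \<partial>?M)"
      unfolding X by (rule nn_integral_indicator[symmetric]) simp
    also have "\<dots> = (\<integral>\<^sup>+x. (\<Prod>i\<in>UNIV. indicator {l $ i<..<u $ i} \<bar>x $ i\<bar>) \<partial>(lborel :: (real ^ 'n) measure))"
      by (subst nn_integral_distr) (simp_all add: ind)
    also have "\<dots> = (\<Prod>i\<in>UNIV. \<integral>\<^sup>+t. indicator {l $ i<..<u $ i} \<bar>t\<bar> \<partial>lborel)"
      by (rule nn_integral_lborel_cart_prod) simp
    also have "\<dots> = (\<Prod>i\<in>UNIV. \<integral>\<^sup>+t. 2 * (indicator {l $ i<..<u $ i} t * indicator {0..} t) \<partial>lborel)"
      by (subst nn_integral_lborel_abs) (simp_all add: nn_integral_cmult)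
    also have "\<dots> = (\<integral>\<^sup>+x. (\<Prod>i\<in>UNIV. 2 * (indicator {l $ i<..<u $ i} (x $ i) * indicator {0..} (x $ i)))
        \<partial>(lborel :: (real ^ 'n) measure))"
      by (rule nn_integral_lborel_cart_prod[symmetric]) simp
    also have "\<dots> = (\<integral>\<^sup>+x. ?d x * indicator (box l u) x \<partial>lborel)"
      by (simp add: ind ind' prod.distrib mult_ac)
    also have "\<dots> = emeasure (density lborel ?d) X"
      unfolding X by (rule emeasure_density[symmetric]) simp_all
    finally show ?thesis .
  qed
  \<comment> \<open>The exhausting boxes are symmetric about the origin, so the preimage of such a
    box under absolute values lies in the box itself.\<close>
  show "emeasure ?M (?A i) \<noteq> \<infinity>" for i
  proof -
    have "emeasure ?M (?A i) = emeasure lborel ((\<lambda>x. \<chi> i. \<bar>x $ i\<bar>) -` ?A i \<inter> space lborel)"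
      by (rule emeasure_distr) auto
    also have "(\<lambda>x. \<chi> i. \<bar>x $ i\<bar>) -` ?A i \<inter> space lborel \<subseteq> ?A i"
      by (auto simp: mem_box_cart abs_less_iff) (metis minus_less_iff)
    then have "emeasure lborel ((\<lambda>x. \<chi> i. \<bar>x $ i\<bar>) -` ?A i \<inter> space lborel) \<le> emeasure lborel (?A i)"
      by (intro emeasure_mono) auto
    also have "\<dots> < \<infinity>"
      by (intro emeasure_bounded_finite bounded_box)
    finally show ?thesis by simp
  qed
qed

text \<open>Half-lines form an intersection-stable generator. Finiteness is asked on each half-line
  only, because the intended measures, images of Lebesgue measure under a norm, have infinite total
  mass.\<close>

lemma measure_eqI_lessThan_halfline:
  fixes M N :: "real measure"
  assumes sets: "sets M = sets borel" "sets N = sets borel"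
    and fin: "\<And>a. emeasure M {..<a} < \<infinity>"
    and eq: "\<And>a. emeasure M {..<a} = emeasure N {..<a}"
  shows "M = N"
proof (rule measure_eqI_generator_eq)
  let ?E = "range (\<lambda>a::real. {..<a})"
  have "{..<a} \<inter> {..<b} = {..<min a b}" for a b :: real by auto
  then show "Int_stable ?E" by (auto simp: Int_stable_def)
  have "sets borel = sigma_sets UNIV ?E"
    by (subst borel_eq_lessThan) (simp add: eucl_less_def[abs_def] lessThan_def[abs_def])
  with sets show "sets M = sigma_sets UNIV ?E" "sets N = sigma_sets UNIV ?E" by auto
  show "(\<Union>i. {..<real i}) = UNIV" by (auto simp: reals_Archimedean2)
  show "emeasure M {..<real i} \<noteq> \<infinity>" for i
    using fin[of "real i"] by simp
  show "emeasure M X = emeasure N X" if "X \<in> ?E" for X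
    using that eq by auto
qed auto

text \<open>The density is the derivative of c a^q, and integrating it back recovers the
  distribution function. For q < 1 it has a singularity at 0, integrable because q > 0. The term
  \<open>max 0 a\<close> says that there is no mass below 0.\<close>

lemma power_cdf_imp_density:
  fixes c q :: real
  assumes q: "q > 0" and c: "c \<ge> 0" and sets: "sets N = sets borel"
    and cdf: "\<And>a. emeasure N {..<a} = ennreal (c * max 0 a powr q)"
  shows "N = density lborel (\<lambda>t. ennreal (c * q * t powr (q - 1)) * indicator {0..} t)"
    (is "N = ?D")
proof (rule measure_eqI_lessThan_halfline)
  fix a :: real
  have "emeasure ?D {..<a} = (\<integral>\<^sup>+t. ennreal (c * q * t powr (q - 1)) * indicator {0..} t * indicator {..<a} t \<partial>lborel)"
    by (subst emeasure_density) auto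
  also have "\<dots> = (\<integral>\<^sup>+t. ennreal (c * q * t powr (q - 1)) * indicator {0..max 0 a} t \<partial>lborel)"
    by (intro nn_integral_cong_AE,
        use AE_lborel_singleton[of 0] AE_lborel_singleton[of a] in eventually_elim)
       (auto simp: indicator_def)
  also have "\<dots> = ennreal (c * q * (max 0 a powr q / q))"
    using has_integral_mult_right[OF has_integral_powr_from_0[of "q - 1" "max 0 a"], of "c * q"] q c
    by (intro nn_integral_has_integral_lebesgue') auto
  also have "\<dots> = emeasure N {..<a}"
    using q by (simp add: cdf)
  finally show "emeasure N {..<a} = emeasure ?D {..<a}" ..
qed (simp_all add: sets cdf)

section \<open>Polar decomposition for the \<open>p\<close>-norm\<close>

lemma powr_le_iff:
  fixes x y :: real
  assumes "p > 0" "0 \<le> x" "0 \<le> y"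
  shows "x powr p \<le> y powr p \<longleftrightarrow> x \<le> y"
  using assms powr_mono2[of p x y] powr_less_mono2[of p y x] by linarith

lemma Lp_norm_nonneg [simp]: "0 \<le> Lp_norm p x"
  by (simp add: Lp_norm_def)

lemma Lp_norm_powr:
  assumes "p > 0"
  shows "Lp_norm p x powr p = (\<Sum>i\<in>UNIV. \<bar>x $ i\<bar> powr p)"
  using assms by (simp add: Lp_norm_def powr_powr sum_nonneg)

lemma Lp_norm_scaleR:
  assumes "p > 0"
  shows "Lp_norm p (c *\<^sub>R x) = \<bar>c\<bar> * Lp_norm p x"
  using assms
  by (simp add: Lp_norm_def abs_mult powr_mult powr_powr sum_nonneg flip: sum_distrib_left)

lemma Lp_norm_abs [simp]: "Lp_norm p (\<chi> i. \<bar>x $ i\<bar>) = Lp_norm p x"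
  by (simp add: Lp_norm_def)

lemma abs_component_le_Lp_norm:
  assumes "p > 0"
  shows "\<bar>x $ i\<bar> \<le> Lp_norm p x"
proof -
  have "\<bar>x $ i\<bar> powr p \<le> Lp_norm p x powr p"
    unfolding Lp_norm_powr[OF assms] by (rule member_le_sum) auto
  then show ?thesis
    using assms by (simp add: powr_le_iff)
qed

lemma Lp_norm_eq_0_iff:
  assumes "p > 0"
  shows "Lp_norm p x = 0 \<longleftrightarrow> x = 0"
  using abs_component_le_Lp_norm[OF assms, of x]
  by (auto simp: vec_eq_iff) (simp add: Lp_norm_def)

lemma Lp_norm_measurable [measurable]: "Lp_norm p \<in> borel_measurable borel"
  unfolding Lp_norm_def[abs_def] by measurable

lemma borel_measurable_vec_nth [measurable (raw)]:
  fixes f :: "'a \<Rightarrow> real ^ 'n"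
  assumes "f \<in> borel_measurable M"
  shows "(\<lambda>x. f x $ i) \<in> borel_measurable M"
  using assms by (rule measurable_compose) (intro borel_measurable_continuous_onI continuous_intros)

lemma cart_abs_measurable [measurable]:
  "(\<lambda>x::real ^ 'n::finite. \<chi> i. \<bar>x $ i\<bar>) \<in> borel_measurable borel"
  by (intro borel_measurable_continuous_onI continuous_intros)

lemma emeasure_lborel_scaleR:
  fixes S :: "'a::euclidean_space set"
  assumes [measurable]: "S \<in> sets borel" and c: "c > 0"
  shows "emeasure lborel S = ennreal (c ^ DIM('a)) * emeasure lborel {x. c *\<^sub>R x \<in> S}"
proof -
  have "emeasure lborel S = emeasure (density (distr lborel borel (\<lambda>x. 0 + c *\<^sub>R x)) (\<lambda>_. \<bar>c\<bar> ^ DIM('a))) S"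
    using lborel_affine[of c "0 :: 'a"] c by simp
  also have "\<dots> = ennreal (c ^ DIM('a)) * emeasure (distr lborel borel (\<lambda>x. c *\<^sub>R x)) S"
    using c by (simp add: emeasure_density nn_integral_cmult)
  also have "emeasure (distr lborel borel (\<lambda>x. c *\<^sub>R x)) S = emeasure lborel {x. c *\<^sub>R x \<in> S}"
    by (subst emeasure_distr) (auto simp: vimage_def)
  finally show ?thesis .
qed

lemma emeasure_Lp_ball:
  assumes p: "p > 0"
  shows "emeasure lborel {x :: real ^ 'n::finite. Lp_norm p x < 1} \<noteq> \<infinity>"
    and "emeasure lborel {x :: real ^ 'n::finite. Lp_norm p x < 1} \<noteq> 0"
proof -
  let ?B = "{x :: real ^ 'n. Lp_norm p x < 1}"
  have "x \<in> cbox (- (\<chi> i. 1)) (\<chi> i. 1)" if "x \<in> ?B" for x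
  proof -
    have "\<bar>x $ i\<bar> \<le> 1" for i
      using abs_component_le_Lp_norm[OF p, of x i] that by simp
    then show ?thesis by (simp add: mem_box_cart abs_le_iff minus_le_iff)
  qed
  then have "bounded ?B" by (meson bounded_cbox bounded_subset subsetI)
  then show "emeasure lborel ?B \<noteq> \<infinity>"
    using emeasure_bounded_finite by (auto simp: less_top)
  show "emeasure lborel ?B \<noteq> 0"
  \<comment> \<open>If the unit ball were null, so would be its dilates by the positive integers,
    and these cover the whole space.\<close>
  proof
    assume 0: "emeasure lborel ?B = 0"
    have "{x :: real ^ 'n. Lp_norm p x < real (Suc k)} \<in> null_sets lborel" for k
    proof -
      have "{x :: real ^ 'n. real (Suc k) *\<^sub>R x \<in> {x. Lp_norm p x < real (Suc k)}} = ?B"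
        by (auto simp del: of_nat_Suc simp: Lp_norm_scaleR[OF p])
      then have "emeasure lborel {x :: real ^ 'n. Lp_norm p x < real (Suc k)} = 0"
        using emeasure_lborel_scaleR[of "{x :: real ^ 'n. Lp_norm p x < real (Suc k)}" "real (Suc k)"] 0
        by (simp del: of_nat_Suc)
      then show ?thesis by (simp add: null_sets_def del: of_nat_Suc)
    qed
    then have "(\<Union>k. {x :: real ^ 'n. Lp_norm p x < real (Suc k)}) \<in> null_sets lborel"
      by (rule null_sets_UN)
    also have "(\<Union>k. {x :: real ^ 'n. Lp_norm p x < real (Suc k)}) = UNIV"
    proof -
      have "\<exists>k. Lp_norm p x < real (Suc k)" for x :: "real ^ 'n"
        by (meson less_trans of_nat_less_iff lessI reals_Archimedean2)
      then show ?thesis by auto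
    qed
    finally show False by (simp add: null_sets_def)
  qed
qed

lemma Lp_uniform_space [simp]: "space (Lp_uniform p) = UNIV" and
  Lp_uniform_sets [simp, measurable_cong]: "sets (Lp_uniform p) = sets borel"
  by (simp_all add: Lp_uniform_def)

lemma Lp_uniform_pos_space [simp]: "space (Lp_uniform_pos p) = UNIV" and
  Lp_uniform_pos_sets [simp, measurable_cong]: "sets (Lp_uniform_pos p) = sets borel"
  by (simp_all add: Lp_uniform_pos_def)

lemma prob_space_Lp_uniform:
  assumes "p > 0"
  shows "prob_space (Lp_uniform p :: (real ^ 'n::finite) measure)"
  unfolding Lp_uniform_def
  by (intro prob_space.prob_space_distr prob_space_uniform_measure emeasure_Lp_ball assms) simp

lemma prob_space_Lp_uniform_pos:
  assumes "p > 0"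
  shows "prob_space (Lp_uniform_pos p :: (real ^ 'n::finite) measure)"
  unfolding Lp_uniform_pos_def
  by (intro prob_space.prob_space_distr prob_space_Lp_uniform assms) simp

lemma AE_Lp_uniform_norm:
  assumes "p > 0"
  shows "AE u in (Lp_uniform p :: (real ^ 'n::finite) measure). Lp_norm p u = 1"
  unfolding Lp_uniform_def
proof (subst AE_distr_iff)
  \<comment> \<open>Only the origin has to be discarded: there division by the norm yields 0, which
    is not on the sphere.\<close>
  have "AE z in uniform_measure lborel {z :: real ^ 'n. Lp_norm p z < 1}. z \<noteq> 0"
    using AE_lborel_singleton[of "0 :: real ^ 'n"]
    by (auto intro!: AE_uniform_measureI elim: eventually_mono)
  then show "AE z in uniform_measure lborel {z :: real ^ 'n. Lp_norm p z < 1}.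
      Lp_norm p (z /\<^sub>R Lp_norm p z) = 1"
    by eventually_elim (simp add: Lp_norm_scaleR Lp_norm_eq_0_iff assms)
qed simp_all

text \<open>The direction of x does not change under positive scaling, so for a > 0 this set is the
  a-fold dilate of the one for radius 1. That one has measure W times the mass of \<open>B\<close>
  by the definition of \<open>Lp_uniform\<close>, W being the volume of the unit ball. For a <= 0
  both sides vanish.\<close>

lemma emeasure_lborel_Lp_cone:
  fixes B :: "(real ^ 'n::finite) set"
  assumes p: "p > 0" and [measurable]: "B \<in> sets borel"
  shows "emeasure lborel {x. Lp_norm p x < a \<and> x /\<^sub>R Lp_norm p x \<in> B} =
    ennreal (max 0 a ^ CARD('n)) * emeasure lborel {x :: real ^ 'n. Lp_norm p x < 1} *
    emeasure (Lp_uniform p) B"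
proof (cases "a > 0")
  case True
  let ?S = "{x :: real ^ 'n. Lp_norm p x < 1}"
  have "{x. a *\<^sub>R x \<in> {x. Lp_norm p x < a \<and> x /\<^sub>R Lp_norm p x \<in> B}} =
      {x. Lp_norm p x < 1 \<and> x /\<^sub>R Lp_norm p x \<in> B}"
    using True by (auto simp: Lp_norm_scaleR p field_simps)
  then have "emeasure lborel {x. Lp_norm p x < a \<and> x /\<^sub>R Lp_norm p x \<in> B} =
      ennreal (a ^ CARD('n)) * emeasure lborel {x. Lp_norm p x < 1 \<and> x /\<^sub>R Lp_norm p x \<in> B}"
    using True by (subst emeasure_lborel_scaleR[of _ a]) auto
  also have "emeasure lborel {x. Lp_norm p x < 1 \<and> x /\<^sub>R Lp_norm p x \<in> B} =
      emeasure lborel ?S * emeasure (Lp_uniform p) B"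
  proof -
    have "emeasure (Lp_uniform p) B = emeasure lborel (?S \<inter> {x. x /\<^sub>R Lp_norm p x \<in> B}) / emeasure lborel ?S"
      unfolding Lp_uniform_def
      by (subst emeasure_distr) (auto simp: vimage_def)
    also have "?S \<inter> {x. x /\<^sub>R Lp_norm p x \<in> B} = {x. Lp_norm p x < 1 \<and> x /\<^sub>R Lp_norm p x \<in> B}"
      by auto
    finally have *: "emeasure (Lp_uniform p) B =
        emeasure lborel {x. Lp_norm p x < 1 \<and> x /\<^sub>R Lp_norm p x \<in> B} / emeasure lborel ?S" .
    show ?thesis
      \<comment> \<open>The ball volume can be cancelled in \<open>ennreal\<close> because it is
        neither 0 nor infinite.\<close>
      unfolding * using emeasure_Lp_ball[OF p, where 'n='n]
      by (simp add: ennreal_times_divide mult.commute[of "emeasure lborel ?S"] mult_divide_eq_ennreal)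
  qed
  finally show ?thesis using True by (simp add: mult.assoc)
next
  case False
  then have "\<not> Lp_norm p x < a" for x :: "real ^ 'n"
    using Lp_norm_nonneg[of p x] by linarith
  with False show ?thesis by simp
qed

lemma emeasure_lborel_Lp_ball:
  assumes p: "p > 0"
  shows "emeasure lborel {x :: real ^ 'n::finite. Lp_norm p x < a} =
    ennreal (max 0 a ^ CARD('n)) * emeasure lborel {x :: real ^ 'n. Lp_norm p x < 1}"
  using emeasure_lborel_Lp_cone[OF p, of "UNIV :: (real ^ 'n) set" a]
    prob_space.emeasure_space_1[OF prob_space_Lp_uniform[OF p, where 'n='n]] by simp

text \<open>The radial factor stays an abstract image of Lebesgue measure, so no Jacobian appears.
  It suffices to compare rectangles A x B, and the cone formula does this when A is a
  half-line.\<close>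

lemma distr_lborel_polar:
  assumes p: "p > 0"
  shows "distr (lborel :: (real ^ 'n::finite) measure) borel (Lp_norm p) \<Otimes>\<^sub>M
      (Lp_uniform p :: (real ^ 'n) measure) =
    distr lborel (borel \<Otimes>\<^sub>M borel) (\<lambda>x. (Lp_norm p x, x /\<^sub>R Lp_norm p x))"
proof (rule pair_measure_eqI)
  interpret U: prob_space "Lp_uniform p :: (real ^ 'n) measure"
    by (rule prob_space_Lp_uniform[OF p])
  let ?T = "distr (lborel :: (real ^ 'n) measure) borel (Lp_norm p)"
  have T: "emeasure ?T {..<a} = emeasure lborel {x :: real ^ 'n. Lp_norm p x < a}" for a
    by (subst emeasure_distr) (auto simp: vimage_def)
  have T_fin: "emeasure ?T {..<a} < \<infinity>" for a
    using emeasure_Lp_ball(1)[OF p, where 'n='n]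
    by (simp add: T emeasure_lborel_Lp_ball[OF p, of a] ennreal_mult_less_top less_top)
  show "sigma_finite_measure ?T"
  proof (rule sigma_finite_measure.intro)
    show "\<exists>A. countable A \<and> A \<subseteq> sets ?T \<and> \<Union> A = space ?T \<and> (\<forall>a\<in>A. emeasure ?T a \<noteq> \<infinity>)"
      using T_fin reals_Archimedean2
      by (intro exI[of _ "range (\<lambda>n::nat. {..<real n})"]) (auto simp: less_top)
  qed
  show "sigma_finite_measure (Lp_uniform p :: (real ^ 'n) measure)" ..
  show "sets (?T \<Otimes>\<^sub>M (Lp_uniform p :: (real ^ 'n) measure)) =
      sets (distr lborel (borel \<Otimes>\<^sub>M borel) (\<lambda>x :: real ^ 'n. (Lp_norm p x, x /\<^sub>R Lp_norm p x)))"
    unfolding sets_distr by (intro sets_pair_measure_cong) simp_all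
  fix A B assume A: "A \<in> sets ?T" and B: "B \<in> sets (Lp_uniform p :: (real ^ 'n) measure)"
  have [measurable]: "A \<in> sets borel" "B \<in> sets borel" using A B by auto
  \<comment> \<open>With \<open>B\<close> fixed, both sides of the rectangle identity are measures
    in the radial set. They agree on half-lines, hence on every Borel set \<open>A\<close>.\<close>
  have "density ?T (\<lambda>_. emeasure (Lp_uniform p) B) =
      distr (density lborel (indicator {x. x /\<^sub>R Lp_norm p x \<in> B})) borel (Lp_norm p)" (is "?L = ?R")
  proof (rule measure_eqI_lessThan_halfline)
    fix a
    have L: "emeasure ?L {..<a} = emeasure (Lp_uniform p) B * emeasure ?T {..<a}"
      by (rule emeasure_density_const) simp
    then show "emeasure ?L {..<a} < \<infinity>"
      using T_fin[of a] U.emeasure_finite[of B]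
      by (metis ennreal_mult_less_top infinity_ennreal_def less_top)
    have "emeasure ?R {..<a} = (\<integral>\<^sup>+x. indicator {x. x /\<^sub>R Lp_norm p x \<in> B} x * indicator {x. Lp_norm p x < a} x \<partial>lborel)"
      by (subst emeasure_distr, simp, simp, subst emeasure_density) (auto simp: vimage_def)
    also have "\<dots> = (\<integral>\<^sup>+x. indicator {x. Lp_norm p x < a \<and> x /\<^sub>R Lp_norm p x \<in> B} x \<partial>lborel)"
      by (intro nn_integral_cong) (auto simp: indicator_def)
    also have "\<dots> = emeasure lborel {x. Lp_norm p x < a \<and> x /\<^sub>R Lp_norm p x \<in> B}"
      by (rule nn_integral_indicator) simp
    finally show "emeasure ?L {..<a} = emeasure ?R {..<a}"
      unfolding L by (simp add: emeasure_lborel_Lp_cone p T emeasure_lborel_Lp_ball[OF p, of a] mult_ac)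
  qed simp_all
  then have "emeasure ?L A = emeasure ?R A" by simp
  also have "emeasure ?L A = emeasure ?T A * emeasure (Lp_uniform p) B"
    by (subst emeasure_density_const) (auto simp: mult.commute)
  also have "emeasure ?R A = (\<integral>\<^sup>+x. indicator {x. x /\<^sub>R Lp_norm p x \<in> B} x * indicator {x. Lp_norm p x \<in> A} x \<partial>lborel)"
    by (subst emeasure_distr, simp, simp, subst emeasure_density) (auto simp: vimage_def)
  also have "\<dots> = (\<integral>\<^sup>+x. indicator {x. Lp_norm p x \<in> A \<and> x /\<^sub>R Lp_norm p x \<in> B} x \<partial>lborel)"
    by (intro nn_integral_cong) (auto simp: indicator_def)
  also have "\<dots> = emeasure lborel {x. Lp_norm p x \<in> A \<and> x /\<^sub>R Lp_norm p x \<in> B}"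
    by (rule nn_integral_indicator) simp
  also have "\<dots> = emeasure (distr lborel (borel \<Otimes>\<^sub>M borel) (\<lambda>x. (Lp_norm p x, x /\<^sub>R Lp_norm p x))) (A \<times> B)"
    by (subst emeasure_distr) (auto simp: vimage_def)
  finally show "emeasure ?T A * emeasure (Lp_uniform p) B =
      emeasure (distr lborel (borel \<Otimes>\<^sub>M borel) (\<lambda>x. (Lp_norm p x, x /\<^sub>R Lp_norm p x))) (A \<times> B)" .
qed

lemma distr_lborel_Lp_norm_powr:
  assumes p: "p > 0"
  defines "W \<equiv> measure lborel {x :: real ^ 'n::finite. Lp_norm p x < 1}"
  shows "distr (lborel :: (real ^ 'n) measure) borel (\<lambda>x. Lp_norm p x powr p) =
    density lborel (\<lambda>t. ennreal (W * (CARD('n) / p) * t powr (CARD('n) / p - 1)) * indicator {0..} t)"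
proof (rule power_cdf_imp_density)
  fix a
  have W: "emeasure lborel {x :: real ^ 'n. Lp_norm p x < 1} = ennreal W"
    using emeasure_Lp_ball(1)[OF p, where 'n='n] by (simp add: W_def emeasure_eq_ennreal_measure)
  have "emeasure (distr (lborel :: (real ^ 'n) measure) borel (\<lambda>x. Lp_norm p x powr p)) {..<a} =
      emeasure lborel {x :: real ^ 'n. Lp_norm p x powr p < a}"
    by (subst emeasure_distr) (auto simp: vimage_def)
  also have "{x :: real ^ 'n. Lp_norm p x powr p < a} = {x. Lp_norm p x < max 0 a powr (1 / p)}"
  proof (cases "a > 0")
    case True
    then have "Lp_norm p x powr p < a \<longleftrightarrow> Lp_norm p x < a powr (1 / p)" for x :: "real ^ 'n"
      using powr_le_iff[of p "a powr (1 / p)" "Lp_norm p x"] p by (simp add: powr_powr flip: not_le)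
    with True show ?thesis by simp
  next
    case False
    then have "\<not> Lp_norm p x powr p < a" "\<not> Lp_norm p x < 0" for x :: "real ^ 'n"
      using powr_ge_zero[of "Lp_norm p x" p] Lp_norm_nonneg[of p x] by linarith+
    with False show ?thesis by simp
  qed
  also have "emeasure lborel \<dots> = ennreal (W * max 0 a powr (CARD('n) / p))"
    unfolding emeasure_lborel_Lp_ball[OF p, of "max 0 a powr (1 / p)"] W
    by (simp add: W_def ennreal_mult' mult.commute powr_powr flip: powr_realpow')
  finally show "emeasure (distr (lborel :: (real ^ 'n) measure) borel (\<lambda>x. Lp_norm p x powr p)) {..<a} =
      ennreal (W * max 0 a powr (CARD('n) / p))" .
qed (use p in \<open>auto simp: W_def\<close>)

section \<open>Bounded laws are determined by their moments\<close>

text \<open>The Taylor remainder of the characteristic function is controlled by the n-th absolute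
  moment, which boundedness reduces to K^n.\<close>

lemma (in real_distribution) char_bounded_approx:
  assumes K: "AE x in M. \<bar>x\<bar> \<le> K"
  shows "cmod (char M t - (\<Sum>k\<le>n. ((\<i> * t) ^ k / fact k) * expectation (\<lambda>x. x ^ k)))
    \<le> 2 * ((\<bar>t\<bar> * K) ^ n / fact n)"
proof -
  have int: "integrable M (\<lambda>x. x ^ k)" for k
    by (rule integrable_const_bound[of _ "K ^ k"], use K in eventually_elim)
       (auto simp: power_abs intro!: power_mono)
  have "expectation (\<lambda>x. \<bar>x\<bar> ^ n) \<le> K ^ n"
    by (rule integral_le_const)
       (use int[of n, THEN integrable_abs] in \<open>simp add: power_abs\<close>,
        use K in eventually_elim, auto intro: power_mono)
  then have "(2 * \<bar>t\<bar> ^ n / fact n) * expectation (\<lambda>x. \<bar>x\<bar> ^ n) \<le> (2 * \<bar>t\<bar> ^ n / fact n) * K ^ n"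
    by (intro mult_left_mono) auto
  with char_approx1[OF int, where n = n and t = t] show ?thesis
    by (simp add: power_mult_distrib)
qed

text \<open>Equal moments give both characteristic functions the same Taylor polynomials. The common
  error bound tends to 0 for every fixed t, because factorials outgrow powers, so the two functions
  coincide and Levy's theorem applies.\<close>

lemma bounded_moments_unique:
  fixes M N :: "real measure"
  assumes M: "real_distribution M" "AE x in M. \<bar>x\<bar> \<le> K"
    and N: "real_distribution N" "AE x in N. \<bar>x\<bar> \<le> K"
    and eq: "\<And>k. (\<integral>x. x ^ k \<partial>M) = (\<integral>x. x ^ k \<partial>N)"
  shows "M = N"
proof (rule Levy_uniqueness[OF M(1) N(1)], rule ext)
  fix t
  have le: "cmod (char M t - char N t) \<le> 4 * ((\<bar>t\<bar> * K) ^ n / fact n)" for n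
  proof -
    let ?S = "\<Sum>k\<le>n. ((\<i> * t) ^ k / fact k) * (\<integral>x. x ^ k \<partial>M)"
    have "cmod (char M t - char N t) \<le> cmod (char M t - ?S) + cmod (char N t - ?S)"
      using norm_triangle_ineq4[of "char M t - ?S" "char N t - ?S"] by simp
    with real_distribution.char_bounded_approx[OF M, where n = n and t = t]
      real_distribution.char_bounded_approx[OF N, where n = n and t = t] show ?thesis
      by (simp add: eq)
  qed
  have "(\<lambda>n. 4 * ((\<bar>t\<bar> * K) ^ n / fact n)) \<longlonglongrightarrow> 4 * 0"
    using summable_LIMSEQ_zero[OF summable_exp[of "\<bar>t\<bar> * K"]]
    by (intro tendsto_mult_left) (simp add: field_simps)
  then have "cmod (char M t - char N t) \<le> 4 * 0"
    by (rule LIMSEQ_le_const) (use le in auto)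
  then show "char M t = char N t" by simp
qed

lemma bounded_nn_moments_unique:
  fixes M N :: "real measure"
  assumes M: "prob_space M" "sets M = sets borel" "AE x in M. 0 \<le> x \<and> x \<le> K"
    and N: "prob_space N" "sets N = sets borel" "AE x in N. 0 \<le> x \<and> x \<le> K"
    and eq: "\<And>k. (\<integral>\<^sup>+x. ennreal (x ^ k) \<partial>M) = (\<integral>\<^sup>+x. ennreal (x ^ k) \<partial>N)"
  shows "M = N"
proof (rule bounded_moments_unique)
  show "real_distribution M" "real_distribution N"
    using M N by (auto simp: real_distribution_def real_distribution_axioms_def)
  show "AE x in M. \<bar>x\<bar> \<le> K" "AE x in N. \<bar>x\<bar> \<le> K"
    using M(3) N(3) by (auto elim: eventually_mono)
  fix k
  have "(\<integral>x. x ^ k \<partial>L) = enn2real (\<integral>\<^sup>+x. ennreal (x ^ k) \<partial>L)"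
    if "AE x in L. 0 \<le> x \<and> x \<le> K" "sets L = sets borel" for L :: "real measure"
    by (rule integral_eq_nn_integral)
       (use that in \<open>auto simp: measurable_cong_sets[OF that(2) refl] elim: eventually_mono\<close>)
  from this[OF M(3,2)] this[OF N(3,2)] eq[of k]
  show "(\<integral>x. x ^ k \<partial>M) = (\<integral>x. x ^ k \<partial>N)" by simp
qed

section \<open>Moments of copulas and uniqueness\<close>

lemma nn_integral_power_uniform_01:
  "(\<integral>\<^sup>+t. ennreal (t ^ k) \<partial>uniform_measure lborel {0<..<1::real}) = ennreal (1 / (real k + 1))"
proof -
  \<comment> \<open>The open interval avoids t = 0, where \<open>0 powr 0\<close> is 0 while
    \<open>0 ^ 0\<close> is 1.\<close>
  have "((\<lambda>t. t powr real k) has_integral (1 / (real k + 1))) {0<..<1::real}"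
    using has_integral_powr_from_0[of "real k" 1] by (simp add: has_integral_Icc_iff_Ioo)
  then have "(\<integral>\<^sup>+t. ennreal (t powr real k) * indicator {0<..<1::real} t \<partial>lborel) = ennreal (1 / (real k + 1))"
    by (intro nn_integral_has_integral_lebesgue') auto
  also have "(\<integral>\<^sup>+t. ennreal (t powr real k) * indicator {0<..<1::real} t \<partial>lborel) =
      (\<integral>\<^sup>+t. ennreal (t ^ k) * indicator {0<..<1::real} t \<partial>lborel)"
    by (intro nn_integral_cong) (auto simp: indicator_def powr_realpow)
  finally show ?thesis
    using divide_ennreal[of "1 / (real k + 1)" 1] by (simp add: nn_integral_uniform_measure)
qed

lemma AE_Lp_uniform_pos_norm:
  assumes "p > 0"
  shows "AE u in (Lp_uniform_pos p :: (real ^ 'n::finite) measure). Lp_norm p u = 1"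
  unfolding Lp_uniform_pos_def
  by (subst AE_distr_iff) (use AE_Lp_uniform_norm[OF assms, where 'n='n] in simp_all)

lemma nn_integral_power_scale_mixture:
  fixes \<rho> :: "real measure" and \<mu> :: "(real ^ 'n::finite) measure"
  assumes "prob_space \<rho>" and [measurable_cong]: "sets \<rho> = sets borel"
    and nn: "AE r in \<rho>. 0 \<le> r"
    and "prob_space \<mu>" and [measurable_cong]: "sets \<mu> = sets borel"
  shows "(\<integral>\<^sup>+x. ennreal ((x $ i) ^ k) \<partial>distr (\<rho> \<Otimes>\<^sub>M \<mu>) borel (\<lambda>(r, u). r *\<^sub>R u)) =
    (\<integral>\<^sup>+r. ennreal (r ^ k) \<partial>\<rho>) * (\<integral>\<^sup>+u. ennreal ((u $ i) ^ k) \<partial>\<mu>)"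
proof -
  interpret \<rho>: prob_space \<rho> by fact
  interpret \<mu>: prob_space \<mu> by fact
  have "(\<integral>\<^sup>+x. ennreal ((x $ i) ^ k) \<partial>distr (\<rho> \<Otimes>\<^sub>M \<mu>) borel (\<lambda>(r, u). r *\<^sub>R u)) =
      (\<integral>\<^sup>+z. ennreal ((fst z * snd z $ i) ^ k) \<partial>(\<rho> \<Otimes>\<^sub>M \<mu>))"
    by (subst nn_integral_distr) (auto intro!: nn_integral_cong simp: case_prod_beta)
  also have "\<dots> = (\<integral>\<^sup>+r. \<integral>\<^sup>+u. ennreal ((r * u $ i) ^ k) \<partial>\<mu> \<partial>\<rho>)"
    by (subst \<mu>.nn_integral_fst[symmetric]) simp_all
  \<comment> \<open>For r >= 0 the factor \<open>r ^ k\<close> can be pulled out of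
    \<open>ennreal\<close> whatever the sign of the power of \<open>u $ i\<close>.\<close>
  also have "\<dots> = (\<integral>\<^sup>+r. ennreal (r ^ k) * (\<integral>\<^sup>+u. ennreal ((u $ i) ^ k) \<partial>\<mu>) \<partial>\<rho>)"
    by (intro nn_integral_cong_AE, use nn in eventually_elim)
       (simp add: power_mult_distrib ennreal_mult' nn_integral_cmult)
  also have "\<dots> = (\<integral>\<^sup>+r. ennreal (r ^ k) \<partial>\<rho>) * (\<integral>\<^sup>+u. ennreal ((u $ i) ^ k) \<partial>\<mu>)"
    by (rule nn_integral_multc) simp
  finally show ?thesis .
qed

lemma copula_moment:
  fixes C :: "(real ^ 'n::finite) measure"
  assumes "copula C"
  shows "(\<integral>\<^sup>+x. ennreal ((x $ i) ^ k) \<partial>C) = ennreal (1 / (real k + 1))"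
proof -
  have [measurable_cong]: "sets C = sets borel" using assms by (simp add: copula_def)
  have "(\<integral>\<^sup>+t. ennreal (t ^ k) \<partial>distr C borel (\<lambda>x. x $ i)) = (\<integral>\<^sup>+x. ennreal ((x $ i) ^ k) \<partial>C)"
    by (rule nn_integral_distr) simp_all
  then show ?thesis
    using assms by (simp add: copula_def nn_integral_power_uniform_01)
qed

text \<open>The coordinates of X = R U lie in [0,1], so the p-th power of the norm of X is at most
  n. That norm equals R, since R >= 0 and U has norm 1.\<close>

lemma copula_radius_bounded:
  fixes \<rho> :: "real measure"
  assumes p: "p > 0" and \<rho>: "prob_space \<rho>" "sets \<rho> = sets borel" "AE r in \<rho>. 0 \<le> r"
    and C: "copula (distr (\<rho> \<Otimes>\<^sub>M Lp_uniform_pos p) borel (\<lambda>(r, u :: real ^ 'n::finite). r *\<^sub>R u))"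
      (is "copula ?C")
  shows "AE r in \<rho>. 0 \<le> r \<and> r \<le> real CARD('n) powr (1 / p)"
proof -
  note [measurable_cong] = \<rho>(2)
  let ?U = "Lp_uniform_pos p :: (real ^ 'n) measure"
  interpret \<rho>: prob_space \<rho> by fact
  interpret U: prob_space ?U by (rule prob_space_Lp_uniform_pos[OF p])
  interpret pair_sigma_finite \<rho> ?U ..
  have "AE x in ?C. Lp_norm p x \<le> real CARD('n) powr (1 / p)"
  proof -
    have "AE x in ?C. \<forall>i. x $ i \<in> {0..1}" using C by (simp add: copula_def)
    then show ?thesis
    proof eventually_elim
      case (elim x)
      then have "\<bar>x $ i\<bar> powr p \<le> 1 powr p" for i
        using p by (intro powr_mono2) auto
      then have "(\<Sum>i\<in>UNIV. \<bar>x $ i\<bar> powr p) \<le> (\<Sum>i\<in>(UNIV :: 'n set). 1)"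
        by (intro sum_mono) simp
      with p show ?case
        unfolding Lp_norm_def by (intro powr_mono2) (auto intro: sum_nonneg)
    qed
  qed
  then have "AE z in \<rho> \<Otimes>\<^sub>M ?U. Lp_norm p (fst z *\<^sub>R snd z) \<le> real CARD('n) powr (1 / p)"
    by (subst (asm) AE_distr_iff) (auto simp: case_prod_beta)
  from AE_pair[OF this] \<rho>(3) show ?thesis
  proof eventually_elim
    case (elim r)
    \<comment> \<open>For fixed r the bound no longer involves u. Holding almost surely under a
      probability measure, it simply holds.\<close>
    from elim(1) AE_Lp_uniform_pos_norm[OF p, where 'n='n]
    have "AE u in ?U. r \<le> real CARD('n) powr (1 / p)"
      by eventually_elim (use elim in \<open>simp add: Lp_norm_scaleR p\<close>)
    with elim show ?case by simp
  qed
qed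

text \<open>A single coordinate already yields all moments of the radius, after division by the k-th
  moment of \<open>u $ i\<close>. The proof checks that this divisor is neither 0 nor
  infinite.\<close>

lemma positive_Lp_spherical_copula_unique:
  fixes C C' :: "(real ^ 'n::finite) measure"
  assumes p: "p > 0"
    and C: "positive_Lp_spherical_copula p C" and C': "positive_Lp_spherical_copula p C'"
  shows "C = C'"
proof -
  let ?U = "Lp_uniform_pos p :: (real ^ 'n) measure"
  interpret U: prob_space ?U by (rule prob_space_Lp_uniform_pos[OF p])
  obtain \<rho> where \<rho>: "prob_space \<rho>" "sets \<rho> = sets borel" "AE r in \<rho>. 0 \<le> r"
    and C_eq: "C = distr (\<rho> \<Otimes>\<^sub>M ?U) borel (\<lambda>(r, u). r *\<^sub>R u)"
    using C by (auto simp: positive_Lp_spherical_copula_def positive_Lp_spherical_def)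
  obtain \<rho>' where \<rho>': "prob_space \<rho>'" "sets \<rho>' = sets borel" "AE r in \<rho>'. 0 \<le> r"
    and C'_eq: "C' = distr (\<rho>' \<Otimes>\<^sub>M ?U) borel (\<lambda>(r, u). r *\<^sub>R u)"
    using C' by (auto simp: positive_Lp_spherical_copula_def positive_Lp_spherical_def)
  have cop: "copula C" "copula C'"
    using C C' by (auto simp: positive_Lp_spherical_copula_def)
  have bounds: "AE r in \<rho>. 0 \<le> r \<and> r \<le> real CARD('n) powr (1 / p)"
    "AE r in \<rho>'. 0 \<le> r \<and> r \<le> real CARD('n) powr (1 / p)"
    using copula_radius_bounded[OF p \<rho>] copula_radius_bounded[OF p \<rho>'] cop
    unfolding C_eq C'_eq by blast+
  fix i :: 'n
  have "\<rho> = \<rho>'"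
  proof (rule bounded_nn_moments_unique)
    fix k
    let ?m = "\<integral>\<^sup>+u. ennreal ((u $ i) ^ k) \<partial>?U"
    have *: "(\<integral>\<^sup>+r. ennreal (r ^ k) \<partial>\<rho>) * ?m = ennreal (1 / (real k + 1))"
      "(\<integral>\<^sup>+r. ennreal (r ^ k) \<partial>\<rho>') * ?m = ennreal (1 / (real k + 1))"
      using copula_moment[OF cop(1), of i k] copula_moment[OF cop(2), of i k]
      unfolding C_eq C'_eq
      by (simp_all add: nn_integral_power_scale_mixture \<rho> \<rho>' U.prob_space_axioms)
    \<comment> \<open>The divisor is nonzero because a multiple of it is positive, and finite
      because coordinates of unit vectors are at most 1 in absolute value.\<close>
    have "ennreal (1 / (real k + 1)) \<noteq> 0" by simp
    with * have "?m \<noteq> 0" by (metis mult_zero_right)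
    moreover have "?m \<le> (\<integral>\<^sup>+u. 1 \<partial>?U)"
    proof (intro nn_integral_mono_AE, use AE_Lp_uniform_pos_norm[OF p, where 'n='n] in eventually_elim)
      fix u :: "real ^ 'n" assume "Lp_norm p u = 1"
      then have "\<bar>u $ i\<bar> \<le> 1" using abs_component_le_Lp_norm[OF p, of u i] by simp
      then have "\<bar>u $ i\<bar> ^ k \<le> 1" by (intro power_le_one) auto
      then show "ennreal ((u $ i) ^ k) \<le> 1"
        by (metis abs_le_iff ennreal_1 ennreal_leI power_abs)
    qed
    then have "?m \<noteq> \<top>" using U.emeasure_space_1 by (auto simp: top_unique)
    ultimately show "(\<integral>\<^sup>+r. ennreal (r ^ k) \<partial>\<rho>) = (\<integral>\<^sup>+r. ennreal (r ^ k) \<partial>\<rho>')"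
      using * by (metis mult_divide_eq_ennreal)
  qed (fact \<rho> \<rho>' bounds)+
  then show ?thesis by (simp add: C_eq C'_eq)
qed

section \<open>Moments of \<open>U\<^sub>n\<close>\<close>

lemma nn_integral_lborel_polar:
  fixes F :: "real \<Rightarrow> real ^ 'n::finite \<Rightarrow> ennreal"
  assumes p: "p > 0" and [measurable]: "case_prod F \<in> borel_measurable (borel \<Otimes>\<^sub>M borel)"
  shows "(\<integral>\<^sup>+x. F (Lp_norm p x) (x /\<^sub>R Lp_norm p x) \<partial>lborel) =
    (\<integral>\<^sup>+r. \<integral>\<^sup>+u. F r u \<partial>Lp_uniform p \<partial>distr (lborel :: (real ^ 'n) measure) borel (Lp_norm p))"
proof -
  interpret U: prob_space "Lp_uniform p :: (real ^ 'n) measure"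
    by (rule prob_space_Lp_uniform[OF p])
  let ?T = "distr (lborel :: (real ^ 'n) measure) borel (Lp_norm p)"
  have "(\<integral>\<^sup>+x. F (Lp_norm p x) (x /\<^sub>R Lp_norm p x) \<partial>lborel) =
      (\<integral>\<^sup>+z. case_prod F z \<partial>(?T \<Otimes>\<^sub>M Lp_uniform p))"
    unfolding distr_lborel_polar[OF p] by (subst nn_integral_distr) simp_all
  also have "\<dots> = (\<integral>\<^sup>+r. \<integral>\<^sup>+u. F r u \<partial>Lp_uniform p \<partial>?T)"
    by (subst U.nn_integral_fst[symmetric]) simp_all
  finally show ?thesis .
qed

text \<open>This includes x = 0, where the quotient is 0 by convention and both sides
  vanish.\<close>

lemma Lp_norm_mult_direction:
  assumes "p > 0"
  shows "Lp_norm p x * \<bar>(x /\<^sub>R Lp_norm p x) $ i\<bar> = \<bar>x $ i\<bar>"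
  using Lp_norm_eq_0_iff[OF assms, of x] by (cases "x = 0") (auto simp: abs_mult)

lemma orthant_measurable [measurable]: "{x :: real ^ 'n::finite. \<forall>i. 0 \<le> x $ i} \<in> sets borel"
  by measurable

section \<open>Folding onto the positive orthant and radial mixtures\<close>

lemma nn_integral_lborel_cart_abs:
  fixes f :: "real ^ 'n::finite \<Rightarrow> ennreal"
  assumes [measurable]: "f \<in> borel_measurable borel"
  shows "(\<integral>\<^sup>+x. f (\<chi> i. \<bar>x $ i\<bar>) \<partial>lborel) =
    (\<integral>\<^sup>+x. 2 ^ CARD('n) * indicator {x. \<forall>i. 0 \<le> x $ i} x * f x \<partial>lborel)"
proof -
  have "(\<integral>\<^sup>+x. f (\<chi> i. \<bar>x $ i\<bar>) \<partial>lborel) = (\<integral>\<^sup>+x. f x \<partial>distr lborel borel (\<lambda>x. \<chi> i. \<bar>x $ i\<bar>))"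
    by (subst nn_integral_distr) simp_all
  also have "\<dots> = (\<integral>\<^sup>+x. 2 ^ CARD('n) * indicator {x. \<forall>i. 0 \<le> x $ i} x * f x \<partial>lborel)"
    unfolding distr_lborel_cart_abs by (rule nn_integral_density) simp_all
  finally show ?thesis .
qed

text \<open>This identifies radial densities on the orthant with laws of R U. The polar formula
  reassembles radius and direction into a point x of the whole space. Taking absolute values folds x
  into the orthant, which produces the factor 2^n and the indicator.\<close>

lemma radial_mixture_eq_density:
  fixes H :: "real \<Rightarrow> ennreal"
  assumes p: "p > 0" and [measurable]: "H \<in> borel_measurable borel"
  shows "distr (density (distr (lborel :: (real ^ 'n::finite) measure) borel (Lp_norm p)) H \<Otimes>\<^sub>M
      Lp_uniform_pos p) borel (\<lambda>(r, u :: real ^ 'n). r *\<^sub>R u) =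
    density lborel (\<lambda>x. 2 ^ CARD('n) * indicator {x. \<forall>i. 0 \<le> x $ i} x * H (Lp_norm p x))"
    (is "distr (density ?T H \<Otimes>\<^sub>M ?U) borel _ = ?R")
proof (rule measure_eqI)
  interpret U: prob_space ?U by (rule prob_space_Lp_uniform_pos[OF p])
  interpret V: prob_space "Lp_uniform p :: (real ^ 'n) measure"
    by (rule prob_space_Lp_uniform[OF p])
  let ?L = "distr (density ?T H \<Otimes>\<^sub>M ?U) borel (\<lambda>(r, u). r *\<^sub>R u)"
  fix A assume "A \<in> sets ?L"
  then have [measurable]: "A \<in> sets borel" by simp
  have "emeasure ?L A = (\<integral>\<^sup>+x. indicator A x \<partial>?L)"
    by (rule nn_integral_indicator[symmetric]) simp
  also have "\<dots> = (\<integral>\<^sup>+z. indicator A (fst z *\<^sub>R snd z) \<partial>(density ?T H \<Otimes>\<^sub>M ?U))"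
    by (subst nn_integral_distr) (auto simp: case_prod_beta)
  also have "\<dots> = (\<integral>\<^sup>+r. \<integral>\<^sup>+u. indicator A (r *\<^sub>R u) \<partial>?U \<partial>density ?T H)"
    by (subst U.nn_integral_fst[symmetric]) simp_all
  also have "\<dots> = (\<integral>\<^sup>+r. H r * (\<integral>\<^sup>+u. indicator A (r *\<^sub>R u) \<partial>?U) \<partial>?T)"
    by (rule nn_integral_density) simp_all
  also have "\<dots> = (\<integral>\<^sup>+r. \<integral>\<^sup>+u. H r * indicator A (r *\<^sub>R (\<chi> i. \<bar>u $ i\<bar>)) \<partial>Lp_uniform p \<partial>?T)"
    by (simp add: Lp_uniform_pos_def nn_integral_distr nn_integral_cmult)
  also have "\<dots> = (\<integral>\<^sup>+x. H (Lp_norm p x) *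
      indicator A (Lp_norm p x *\<^sub>R (\<chi> i. \<bar>(x /\<^sub>R Lp_norm p x) $ i\<bar>)) \<partial>lborel)"
    by (rule nn_integral_lborel_polar[OF p, symmetric]) simp
  also have "\<dots> = (\<integral>\<^sup>+x. H (Lp_norm p (\<chi> i. \<bar>x $ i\<bar>)) * indicator A (\<chi> i. \<bar>x $ i\<bar>) \<partial>lborel)"
  proof -
    have "Lp_norm p x *\<^sub>R (\<chi> i. \<bar>(x /\<^sub>R Lp_norm p x) $ i\<bar>) = (\<chi> i. \<bar>x $ i\<bar>)" for x :: "real ^ 'n"
      by (simp only: vec_eq_iff vector_scaleR_component vec_lambda_beta real_scaleR_def
          Lp_norm_mult_direction[OF p, unfolded vector_scaleR_component real_scaleR_def]) simp
    then show ?thesis by simp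
  qed
  also have "\<dots> = (\<integral>\<^sup>+x. 2 ^ CARD('n) * indicator {x. \<forall>i. 0 \<le> x $ i} x * (H (Lp_norm p x) * indicator A x) \<partial>lborel)"
    by (rule nn_integral_lborel_cart_abs) simp
  also have "\<dots> = emeasure ?R A"
    by (subst emeasure_density) (simp_all add: mult.assoc)
  finally show "emeasure ?L A = emeasure ?R A" .
qed simp

section \<open>Radial integrals, Gamma and Beta integrals\<close>

lemma nn_integral_absorb_powr:
  fixes G :: "real \<Rightarrow> ennreal"
  shows "(\<integral>\<^sup>+t. ennreal (c * t powr (a - 1)) * indicator {0..} t * (ennreal (t powr b) * G t) \<partial>lborel) =
    (\<integral>\<^sup>+t. ennreal (c * t powr (a + b - 1)) * indicator {0..} t * G t \<partial>lborel)"
proof (rule nn_integral_cong)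
  fix t :: real
  have "t powr (a + b - 1) = t powr (a - 1) * t powr b"
    by (metis add_diff_eq diff_add_eq powr_add)
  then have "ennreal (c * t powr (a + b - 1)) = ennreal (c * t powr (a - 1)) * ennreal (t powr b)"
    by (simp add: ennreal_mult'' flip: mult.assoc)
  then show "ennreal (c * t powr (a - 1)) * indicator {0..} t * (ennreal (t powr b) * G t) =
      ennreal (c * t powr (a + b - 1)) * indicator {0..} t * G t"
    by (simp only: mult_ac)
qed

text \<open>Writing |x_i|^k as r^k |u_i|^k separates the moment of the direction from an integral
  over t = r^p. There r^k = t^(k/p) raises the exponent n/p - 1 to (n+k)/p - 1. The formula is used
  twice, with G(t) = exp(-t) and with the copula profile, so the unknown direction moment can be
  eliminated.\<close>

lemma nn_integral_power_radial:
  fixes G :: "real \<Rightarrow> ennreal" and i :: "'n::finite"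
  assumes p: "p > 0" and [measurable]: "G \<in> borel_measurable borel"
  defines "W \<equiv> measure lborel {x :: real ^ 'n. Lp_norm p x < 1}"
  shows "(\<integral>\<^sup>+x. ennreal (\<bar>x $ i\<bar> ^ k) * G (Lp_norm p x powr p) \<partial>(lborel :: (real ^ 'n) measure)) =
    (\<integral>\<^sup>+u. ennreal (\<bar>u $ i\<bar> ^ k) \<partial>(Lp_uniform p :: (real ^ 'n) measure)) *
    (\<integral>\<^sup>+t. ennreal (W * (CARD('n) / p) * t powr ((CARD('n) + k) / p - 1)) * indicator {0..} t * G t \<partial>lborel)"
    (is "_ = ?m * ?J")
proof -
  let ?T = "distr (lborel :: (real ^ 'n) measure) borel (Lp_norm p)"
  let ?F = "\<lambda>r u :: real ^ 'n. ennreal (r ^ k) * ennreal (\<bar>u $ i\<bar> ^ k) * G (r powr p)"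
  have "(\<integral>\<^sup>+x. ennreal (\<bar>x $ i\<bar> ^ k) * G (Lp_norm p x powr p) \<partial>lborel) =
      (\<integral>\<^sup>+x. ?F (Lp_norm p x) (x /\<^sub>R Lp_norm p x) \<partial>lborel)"
  proof (rule nn_integral_cong)
    fix x :: "real ^ 'n"
    have "\<bar>x $ i\<bar> ^ k = Lp_norm p x ^ k * \<bar>(x /\<^sub>R Lp_norm p x) $ i\<bar> ^ k"
      by (subst power_mult_distrib[symmetric]) (simp only: Lp_norm_mult_direction[OF p])
    then show "ennreal (\<bar>x $ i\<bar> ^ k) * G (Lp_norm p x powr p) = ?F (Lp_norm p x) (x /\<^sub>R Lp_norm p x)"
      by (simp only: ennreal_mult zero_le_power abs_ge_zero Lp_norm_nonneg)
  qed
  also have "\<dots> = (\<integral>\<^sup>+r. \<integral>\<^sup>+u. ?F r u \<partial>Lp_uniform p \<partial>?T)"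
    by (rule nn_integral_lborel_polar[OF p]) simp
  also have "\<dots> = (\<integral>\<^sup>+r. ?m * (ennreal (r ^ k) * G (r powr p)) \<partial>?T)"
    by (simp add: nn_integral_cmult nn_integral_multc mult_ac)
  also have "\<dots> = ?m * (\<integral>\<^sup>+x. ennreal (Lp_norm p x ^ k) * G (Lp_norm p x powr p) \<partial>(lborel :: (real ^ 'n) measure))"
    by (simp add: nn_integral_cmult nn_integral_distr)
  also have "(\<integral>\<^sup>+x. ennreal (Lp_norm p x ^ k) * G (Lp_norm p x powr p) \<partial>(lborel :: (real ^ 'n) measure)) =
      (\<integral>\<^sup>+x. ennreal ((Lp_norm p x powr p) powr (k / p)) * G (Lp_norm p x powr p) \<partial>(lborel :: (real ^ 'n) measure))"
  \<comment> \<open>The origin is left out because for k = 0 the power \<open>0 ^ 0\<close> is 1,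
    whereas \<open>0 powr 0\<close> is 0.\<close>
  proof (rule nn_integral_cong_AE, use AE_lborel_singleton[of "0 :: real ^ 'n"] in eventually_elim)
    fix x :: "real ^ 'n" assume "x \<noteq> 0"
    then have "Lp_norm p x > 0"
      using Lp_norm_eq_0_iff[OF p, of x] Lp_norm_nonneg[of p x] by linarith
    then show "ennreal (Lp_norm p x ^ k) * G (Lp_norm p x powr p) =
        ennreal ((Lp_norm p x powr p) powr (k / p)) * G (Lp_norm p x powr p)"
      using p by (simp add: powr_powr powr_realpow)
  qed
  also have "\<dots> = (\<integral>\<^sup>+t. ennreal (t powr (k / p)) * G t
      \<partial>distr (lborel :: (real ^ 'n) measure) borel (\<lambda>x. Lp_norm p x powr p))"
    by (subst nn_integral_distr) simp_all
  also have "\<dots> = (\<integral>\<^sup>+t. ennreal (W * (CARD('n) / p) * t powr (CARD('n) / p - 1)) * indicator {0..} t *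
      (ennreal (t powr (k / p)) * G t) \<partial>lborel)"
    unfolding distr_lborel_Lp_norm_powr[OF p] W_def by (rule nn_integral_density) simp_all
  also have "\<dots> = ?J"
    by (simp only: nn_integral_absorb_powr of_nat_add add_divide_distrib)
  finally show ?thesis .
qed

lemma nn_integral_Gamma:
  assumes "s > 0" "c \<ge> 0"
  shows "(\<integral>\<^sup>+t. ennreal (c * t powr (s - 1)) * indicator {0..} t * ennreal (exp (- t)) \<partial>lborel) =
    ennreal (c * Gamma s)"
proof -
  have "(\<integral>\<^sup>+t. ennreal (c * t powr (s - 1)) * indicator {0..} t * ennreal (exp (- t)) \<partial>lborel) =
      (\<integral>\<^sup>+t. ennreal c * ennreal (indicator {0..} t * t powr (s - 1) / exp t) \<partial>lborel)"
    using assms by (intro nn_integral_cong)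
      (auto simp: indicator_def exp_minus field_simps simp flip: ennreal_mult')
  also have "\<dots> = ennreal c * ennreal (Gamma s)"
    using assms by (simp add: nn_integral_cmult Gamma_conv_nn_integral_real)
  finally show ?thesis using assms by (simp add: ennreal_mult')
qed

text \<open>The substitution s = |t|^p is again made through a distribution function: the set where
  |t|^p < a is an interval of length 2 a^(1/p). What remains is a Gamma integral.\<close>

lemma nn_integral_power_exp_abs_powr:
  assumes p: "p > 0"
  shows "(\<integral>\<^sup>+t. ennreal (\<bar>t\<bar> ^ k) * ennreal (exp (- (\<bar>t\<bar> powr p))) \<partial>lborel) =
    ennreal (2 / p * Gamma ((real k + 1) / p))"
proof -
  have law: "distr lborel borel (\<lambda>t::real. \<bar>t\<bar> powr p) =
      density lborel (\<lambda>t. ennreal (2 * (1 / p) * t powr (1 / p - 1)) * indicator {0..} t)"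
  proof (rule power_cdf_imp_density)
    fix a :: real
    have "emeasure (distr lborel borel (\<lambda>t::real. \<bar>t\<bar> powr p)) {..<a} = emeasure lborel {t::real. \<bar>t\<bar> powr p < a}"
      by (subst emeasure_distr) (auto simp: vimage_def)
    also have "{t::real. \<bar>t\<bar> powr p < a} = {- (max 0 a powr (1 / p))<..<max 0 a powr (1 / p)}"
    proof (cases "a > 0")
      case True
      then have "\<bar>t\<bar> powr p < a \<longleftrightarrow> \<bar>t\<bar> < a powr (1 / p)" for t
        using powr_le_iff[of p "a powr (1 / p)" "\<bar>t\<bar>"] p by (simp add: powr_powr flip: not_le)
      moreover have "{t. \<bar>t\<bar> < s} = {- s<..<s}" for s :: real by auto
      ultimately show ?thesis using True by simp
    next
      case False
      then have "\<not> \<bar>t\<bar> powr p < a" for t using powr_ge_zero[of "\<bar>t\<bar>" p] by linarith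
      with False show ?thesis by simp
    qed
    also have "emeasure lborel \<dots> = ennreal (2 * max 0 a powr (1 / p))"
      by simp
    finally show "emeasure (distr lborel borel (\<lambda>t::real. \<bar>t\<bar> powr p)) {..<a} = ennreal (2 * max 0 a powr (1 / p))" .
  qed (use p in simp_all)
  have "(\<integral>\<^sup>+t. ennreal (\<bar>t\<bar> ^ k) * ennreal (exp (- (\<bar>t\<bar> powr p))) \<partial>lborel) =
      (\<integral>\<^sup>+t. ennreal ((\<bar>t\<bar> powr p) powr (k / p)) * ennreal (exp (- (\<bar>t\<bar> powr p))) \<partial>lborel)"
    by (rule nn_integral_cong_AE, use AE_lborel_singleton[of "0 :: real"] in eventually_elim)
       (use p in \<open>simp add: powr_powr powr_realpow\<close>)
  also have "\<dots> = (\<integral>\<^sup>+t. ennreal (t powr (k / p)) * ennreal (exp (- t)) \<partial>distr lborel borel (\<lambda>t::real. \<bar>t\<bar> powr p))"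
    by (subst nn_integral_distr) simp_all
  also have "\<dots> = (\<integral>\<^sup>+t. ennreal (2 * (1 / p) * t powr (1 / p - 1)) * indicator {0..} t *
      (ennreal (t powr (k / p)) * ennreal (exp (- t))) \<partial>lborel)"
    unfolding law by (rule nn_integral_density) simp_all
  also have "\<dots> = (\<integral>\<^sup>+t. ennreal (2 / p * t powr ((real k + 1) / p - 1)) * indicator {0..} t * ennreal (exp (- t)) \<partial>lborel)"
    by (simp only: nn_integral_absorb_powr add.commute[of "real k"] add_divide_distrib) simp
  also have "\<dots> = ennreal (2 / p * Gamma ((real k + 1) / p))"
    using p by (intro nn_integral_Gamma) auto
  finally show ?thesis .
qed

text \<open>Both sides evaluate the integral of |x_i|^k exp(-||x||_p^p), the left in polar form and
  the right coordinate by coordinate. The moment stays multiplied by \<open>W\<close> and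
  \<open>Gamma\<close>, since exactly this product occurs in the moments of the copula.\<close>

lemma Lp_uniform_moment:
  fixes i :: "'n::finite"
  assumes p: "p > 0"
  defines "W \<equiv> measure lborel {x :: real ^ 'n. Lp_norm p x < 1}"
  shows "(\<integral>\<^sup>+u. ennreal (\<bar>u $ i\<bar> ^ k) \<partial>(Lp_uniform p :: (real ^ 'n) measure)) *
      ennreal (W * (CARD('n) / p) * Gamma ((CARD('n) + k) / p)) =
    ennreal (2 / p * Gamma ((real k + 1) / p) * (2 / p * Gamma (1 / p)) ^ (CARD('n) - 1))"
proof -
  \<comment> \<open>With exponent \<open>k\<close> at coordinate \<open>i\<close> and 0 elsewhere,
    the integrand becomes a product over all coordinates.\<close>
  let ?f = "\<lambda>j t. ennreal (\<bar>t\<bar> ^ (if j = i then k else 0)) * ennreal (exp (- (\<bar>t\<bar> powr p)))"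
  have "(\<integral>\<^sup>+u. ennreal (\<bar>u $ i\<bar> ^ k) \<partial>(Lp_uniform p :: (real ^ 'n) measure)) *
      ennreal (W * (CARD('n) / p) * Gamma ((CARD('n) + k) / p)) =
      (\<integral>\<^sup>+x. ennreal (\<bar>x $ i\<bar> ^ k) * ennreal (exp (- (Lp_norm p x powr p))) \<partial>(lborel :: (real ^ 'n) measure))"
  proof -
    have "(\<integral>\<^sup>+x. ennreal (\<bar>x $ i\<bar> ^ k) * ennreal (exp (- (Lp_norm p x powr p))) \<partial>(lborel :: (real ^ 'n) measure)) =
        (\<integral>\<^sup>+u. ennreal (\<bar>u $ i\<bar> ^ k) \<partial>(Lp_uniform p :: (real ^ 'n) measure)) *
        (\<integral>\<^sup>+t. ennreal (W * (CARD('n) / p) * t powr ((CARD('n) + k) / p - 1)) * indicator {0..} t *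
          ennreal (exp (- t)) \<partial>lborel)"
      unfolding W_def by (rule nn_integral_power_radial[OF p]) simp
    also have "(\<integral>\<^sup>+t. ennreal (W * (CARD('n) / p) * t powr ((CARD('n) + k) / p - 1)) * indicator {0..} t *
          ennreal (exp (- t)) \<partial>lborel) = ennreal (W * (CARD('n) / p) * Gamma ((CARD('n) + k) / p))"
      by (rule nn_integral_Gamma) (use p in \<open>auto simp: W_def intro!: add_pos_nonneg divide_pos_pos\<close>)
    finally show ?thesis ..
  qed
  also have "\<dots> = (\<integral>\<^sup>+x. (\<Prod>j\<in>UNIV. ?f j (x $ j)) \<partial>(lborel :: (real ^ 'n) measure))"
  proof (rule nn_integral_cong)
    fix x :: "real ^ 'n"
    have "(\<Prod>j\<in>UNIV. \<bar>x $ j\<bar> ^ (if j = i then k else 0)) = (\<Prod>j\<in>UNIV. if j = i then \<bar>x $ i\<bar> ^ k else 1)"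
      by (rule prod.cong) auto
    also have "\<dots> = \<bar>x $ i\<bar> ^ k" by simp
    finally have "(\<Prod>j\<in>UNIV. ennreal (\<bar>x $ j\<bar> ^ (if j = i then k else 0))) = ennreal (\<bar>x $ i\<bar> ^ k)"
      by (subst prod_ennreal) simp_all
    moreover have "(\<Prod>j\<in>UNIV. ennreal (exp (- (\<bar>x $ j\<bar> powr p)))) = ennreal (exp (- (Lp_norm p x powr p)))"
      by (subst prod_ennreal) (simp_all add: Lp_norm_powr[OF p] sum_negf flip: exp_sum)
    ultimately show "ennreal (\<bar>x $ i\<bar> ^ k) * ennreal (exp (- (Lp_norm p x powr p))) = (\<Prod>j\<in>UNIV. ?f j (x $ j))"
      by (simp add: prod.distrib)
  qed
  also have "\<dots> = (\<Prod>j\<in>UNIV. \<integral>\<^sup>+t. ?f j t \<partial>lborel)"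
    by (rule nn_integral_lborel_cart_prod) simp
  also have "\<dots> = (\<Prod>j\<in>UNIV. ennreal (2 / p * Gamma ((real (if j = i then k else 0) + 1) / p)))"
    by (simp only: nn_integral_power_exp_abs_powr[OF p])
  also have "\<dots> = ennreal (\<Prod>j\<in>UNIV. 2 / p * Gamma ((real (if j = i then k else 0) + 1) / p))"
    using p by (intro prod_ennreal mult_nonneg_nonneg less_imp_le[OF Gamma_real_pos]) (auto intro!: divide_pos_pos)
  also have "(\<Prod>j\<in>UNIV. 2 / p * Gamma ((real (if j = i then k else 0) + 1) / p)) =
      2 / p * Gamma ((real k + 1) / p) * (\<Prod>j\<in>UNIV - {i}. 2 / p * Gamma ((real (if j = i then k else 0) + 1) / p))"
    by (subst prod.remove[of _ i]) simp_all
  also have "(\<Prod>j\<in>UNIV - {i}. 2 / p * Gamma ((real (if j = i then k else 0) + 1) / p)) =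
      (\<Prod>j\<in>UNIV - {i}. 2 / p * Gamma (1 / p))"
    by (rule prod.cong) auto
  also have "\<dots> = (2 / p * Gamma (1 / p)) ^ (CARD('n) - 1)"
    by (simp add: card_Diff_singleton)
  finally show ?thesis .
qed

lemma nn_integral_Beta:
  assumes "a > 0" "b > 0" "c \<ge> 0" "d \<ge> 0"
  shows "(\<integral>\<^sup>+t. ennreal (c * t powr (a - 1)) * indicator {0..} t *
      ennreal (if t < 1 then d * (1 - t) powr (b - 1) else 0) \<partial>lborel) = ennreal (c * d * Beta a b)"
proof -
  have "((\<lambda>t. c * d * (t powr (a - 1) * (1 - t) powr (b - 1))) has_integral c * d * Beta a b) {0..1}"
    by (intro has_integral_mult_right has_integral_Beta_real assms)
  then have "(\<integral>\<^sup>+t. ennreal (c * d * (t powr (a - 1) * (1 - t) powr (b - 1))) * indicator {0..1} t \<partial>lborel) =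
      ennreal (c * d * Beta a b)"
    using assms by (intro nn_integral_has_integral_lebesgue') auto
  also have "(\<integral>\<^sup>+t. ennreal (c * d * (t powr (a - 1) * (1 - t) powr (b - 1))) * indicator {0..1} t \<partial>lborel) =
      (\<integral>\<^sup>+t. ennreal (c * t powr (a - 1)) * indicator {0..} t *
      ennreal (if t < 1 then d * (1 - t) powr (b - 1) else 0) \<partial>lborel)"
    by (rule nn_integral_cong_AE, use AE_lborel_singleton[of "1 :: real"] in eventually_elim)
       (use assms in \<open>auto simp: indicator_def mult_ac simp flip: ennreal_mult\<close>)
  finally show ?thesis .
qed

section \<open>The copula\<close>

text \<open>The claimed density at \<open>\<parallel>x\<parallel>\<^sub>p\<^sup>p = t\<close>, divided by \<open>2\<^sup>n\<close>: it is spread over all orthants, and taking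
  absolute values folds them back together.\<close>

definition Lp_copula_radial :: "nat \<Rightarrow> real \<Rightarrow> real \<Rightarrow> ennreal" where
  "Lp_copula_radial n p t = ennreal
     (if t < 1
      then 1 / (2 ^ n * Gamma (1 + 1 / p) ^ (n - 1) * Gamma (1 - (real n - 1) / p)) *
        (1 - t) powr (- (real n - 1) / p)
      else 0)"

text \<open>The body has the shape of the right-hand side of
  \<open>radial_mixture_eq_density\<close>, with the profile taken at r^p.\<close>

definition Lp_copula :: "real \<Rightarrow> (real ^ 'n) measure" where
  "Lp_copula p = density lborel (\<lambda>x. 2 ^ CARD('n) * indicator {x. \<forall>i. 0 \<le> x $ i} x *
     Lp_copula_radial CARD('n) p (Lp_norm p x powr p))"

lemma Lp_copula_radial_measurable [measurable]: "Lp_copula_radial n p \<in> borel_measurable borel"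
  unfolding Lp_copula_radial_def[abs_def] by measurable

lemma sets_Lp_copula [simp, measurable_cong]: "sets (Lp_copula p) = sets borel"
  and space_Lp_copula [simp]: "space (Lp_copula p) = UNIV"
  by (simp_all add: Lp_copula_def)

text \<open>The recursion Gamma(1+s) = s Gamma(s) does two things. At s = 1/p it matches the product
  of n-1 coordinate integrals with the normalising constant. At s = (k+1)/p it leaves the factor
  1/(k+1). The variable \<open>g\<close> stands for Gamma(1 - (n-1)/p), which cancels.\<close>

lemma Gamma_moment_identity:
  fixes p g b :: real
  assumes "p > 0" "n > 0" "g > 0"
  shows "2 / p * Gamma ((real k + 1) / p) * (2 / p * Gamma (1 / p)) ^ (n - 1) *
      (1 / (2 ^ n * Gamma (1 + 1 / p) ^ (n - 1) * g) * g / Gamma (1 + (real k + 1) / p)) =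
    1 / (real k + 1)"
proof -
  have rec: "Gamma (1 + s) = s * Gamma s" if "s > 0" for s :: real
  proof -
    have "s \<notin> \<int>\<^sub>\<le>\<^sub>0" using that by (auto elim!: nonpos_Ints_cases)
    then show ?thesis using Gamma_plus1[of s] by (simp add: add.commute)
  qed
  have 1: "2 / p * Gamma (1 / p) = 2 * Gamma (1 + 1 / p)"
    using rec[of "1 / p"] assms by simp
  have 2: "Gamma (1 + (real k + 1) / p) = (real k + 1) / p * Gamma ((real k + 1) / p)"
    using assms by (intro rec) (auto intro: divide_pos_pos)
  have 3: "Gamma ((real k + 1) / p) > 0" "Gamma (1 + 1 / p) > 0"
    using assms by (auto intro!: Gamma_real_pos divide_pos_pos add_pos_pos)
  have 4: "(2::real) ^ n = 2 * 2 ^ (n - 1)"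
    using assms by (metis Suc_diff_1 power_Suc)
  define A B where "A = Gamma ((real k + 1) / p)" and "B = Gamma (1 + 1 / p)"
  have "A > 0" "B > 0" "real k + 1 > 0" using 3 by (simp_all add: A_def B_def)
  then show ?thesis
    unfolding 1 2 4 A_def[symmetric] B_def[symmetric]
    using assms by (simp add: power_mult_distrib)
qed

text \<open>Unfolding the orthant and passing to t = ||x||_p^p gives the direction moment times a
  Beta integral. Its factor \<open>Gamma a\<close> completes the product known from
  \<open>Lp_uniform_moment\<close>, so neither \<open>W\<close> nor \<open>m\<close> has to be
  computed.\<close>

lemma Lp_copula_moment:
  fixes i :: "'n::finite"
  assumes p: "p > 0" "p > real CARD('n) - 1"
  shows "(\<integral>\<^sup>+x. ennreal ((x $ i) ^ k) \<partial>(Lp_copula p :: (real ^ 'n) measure)) = ennreal (1 / (real k + 1))"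
proof -
  define W where "W = measure lborel {x :: real ^ 'n. Lp_norm p x < 1}"
  \<comment> \<open>The exponent of 1 - t in the density is b - 1. Since p > n - 1, b is positive
    and the singularity on the unit sphere is integrable.\<close>
  define b where "b = 1 - (real CARD('n) - 1) / p"
  define d where "d = 1 / (2 ^ CARD('n) * Gamma (1 + 1 / p) ^ (CARD('n) - 1) * Gamma b)"
  define a where "a = (CARD('n) + k) / p"
  define m where "m = (\<integral>\<^sup>+u. ennreal (\<bar>u $ i\<bar> ^ k) \<partial>(Lp_uniform p :: (real ^ 'n) measure))"
  let ?G = "Lp_copula_radial CARD('n) p"
  have b: "b > 0" using p by (simp add: b_def)
  have a: "a > 0" using p by (auto simp: a_def intro!: divide_pos_pos add_pos_nonneg)
  have W: "W \<ge> 0" by (simp add: W_def)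
  have Gb: "Gamma b > 0" using b by (rule Gamma_real_pos)
  have d: "d \<ge> 0"
    using Gb p Gamma_real_pos[of "1 + 1 / p"] by (auto simp: d_def add_pos_pos)
  have G: "?G t = ennreal (if t < 1 then d * (1 - t) powr (b - 1) else 0)" for t
    by (simp add: Lp_copula_radial_def d_def b_def minus_divide_left)
  have "(\<integral>\<^sup>+x. ennreal ((x $ i) ^ k) \<partial>(Lp_copula p :: (real ^ 'n) measure)) =
      (\<integral>\<^sup>+x. 2 ^ CARD('n) * indicator {x. \<forall>i. 0 \<le> x $ i} x *
        (?G (Lp_norm p x powr p) * ennreal ((x $ i) ^ k)) \<partial>(lborel :: (real ^ 'n) measure))"
    unfolding Lp_copula_def by (subst nn_integral_density) (simp_all add: mult.assoc)
  also have "\<dots> = (\<integral>\<^sup>+x. ?G (Lp_norm p (\<chi> i. \<bar>x $ i\<bar>) powr p) * ennreal (((\<chi> i. \<bar>x $ i\<bar>) $ i) ^ k)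
      \<partial>(lborel :: (real ^ 'n) measure))"
    by (rule nn_integral_lborel_cart_abs[symmetric]) simp
  also have "\<dots> = (\<integral>\<^sup>+x. ennreal (\<bar>x $ i\<bar> ^ k) * ?G (Lp_norm p x powr p) \<partial>(lborel :: (real ^ 'n) measure))"
    by (simp add: mult.commute)
  also have "\<dots> = m * (\<integral>\<^sup>+t. ennreal (W * (CARD('n) / p) * t powr (a - 1)) * indicator {0..} t * ?G t \<partial>lborel)"
    unfolding m_def W_def a_def by (rule nn_integral_power_radial[OF p(1)]) simp
  also have "\<dots> = m * ennreal (W * (CARD('n) / p) * d * Beta a b)"
    unfolding G using a b W d p(1) by (subst nn_integral_Beta) simp_all
  also have "W * (CARD('n) / p) * d * Beta a b = (W * (CARD('n) / p) * Gamma a) * (d * Gamma b / Gamma (1 + (real k + 1) / p))"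
  proof -
    \<comment> \<open>The dimension drops out of the sum, which is why the moments do not depend on
      it.\<close>
    have "a + b = 1 + (real k + 1) / p"
      using p(1) by (simp add: a_def b_def field_simps)
    then show ?thesis by (simp add: Beta_def)
  qed
  also have "m * ennreal \<dots> =
      (m * ennreal (W * (CARD('n) / p) * Gamma a)) * ennreal (d * Gamma b / Gamma (1 + (real k + 1) / p))"
  proof -
    have "0 \<le> W * (CARD('n) / p) * Gamma a"
      using W p(1) Gamma_real_pos[OF a] by simp
    then show ?thesis
      by (subst ennreal_mult') (auto simp only: mult.assoc)
  qed
  also have "m * ennreal (W * (CARD('n) / p) * Gamma a) =
      ennreal (2 / p * Gamma ((real k + 1) / p) * (2 / p * Gamma (1 / p)) ^ (CARD('n) - 1))"
    unfolding m_def W_def a_def by (rule Lp_uniform_moment[OF p(1)])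
  also have "\<dots> * ennreal (d * Gamma b / Gamma (1 + (real k + 1) / p)) =
      ennreal (2 / p * Gamma ((real k + 1) / p) * (2 / p * Gamma (1 / p)) ^ (CARD('n) - 1) *
        (d * Gamma b / Gamma (1 + (real k + 1) / p)))"
    using p(1) Gamma_real_pos[of "1 / p"] Gamma_real_pos[of "(real k + 1) / p"]
    by (intro ennreal_mult'[symmetric]) (simp add: add_nonneg_pos)
  also have "\<dots> = ennreal (1 / (real k + 1))"
    unfolding d_def using Gamma_moment_identity[OF p(1) zero_less_card_finite[where 'a='n] Gb, of k] by simp
  finally show ?thesis .
qed

lemma prob_space_Lp_copula:
  assumes p: "p > 0" "p > real CARD('n::finite) - 1"
  shows "prob_space (Lp_copula p :: (real ^ 'n) measure)"
proof
  fix i :: 'n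
  \<comment> \<open>The total mass is the moment of order 0.\<close>
  show "emeasure (Lp_copula p :: (real ^ 'n) measure) (space (Lp_copula p)) = 1"
    using Lp_copula_moment[OF p, of i 0] by simp
qed

lemma AE_Lp_copula_cube:
  assumes p: "p > 0"
  shows "AE x in (Lp_copula p :: (real ^ 'n::finite) measure). \<forall>i. x $ i \<in> {0..1}"
  unfolding Lp_copula_def
\<comment> \<open>Where the density is positive, x lies in the orthant and its norm is below 1,
  which bounds every coordinate.\<close>
proof (subst AE_density, simp, rule AE_I2, intro impI allI)
  fix x :: "real ^ 'n" and i
  assume D: "0 < 2 ^ CARD('n) * indicator {x. \<forall>i. 0 \<le> x $ i} x * Lp_copula_radial CARD('n) p (Lp_norm p x powr p)"
  then have x: "\<forall>i. 0 \<le> x $ i" by (cases "\<forall>i. 0 \<le> x $ i") auto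
  from D have "Lp_copula_radial CARD('n) p (Lp_norm p x powr p) \<noteq> 0" by auto
  then have "Lp_norm p x powr p < 1 powr p" by (auto simp: Lp_copula_radial_def split: if_splits)
  then have "Lp_norm p x \<le> 1"
    using powr_le_iff[OF p, of "Lp_norm p x" 1] by simp
  then show "x $ i \<in> {0..1}"
    using abs_component_le_Lp_norm[OF p, of x i] x by auto
qed

lemma copula_Lp_copula:
  assumes p: "p > 0" "p > real CARD('n::finite) - 1"
  shows "copula (Lp_copula p :: (real ^ 'n) measure)"
  unfolding copula_def
proof (intro conjI allI)
  let ?C = "Lp_copula p :: (real ^ 'n) measure"
  show C: "prob_space ?C" by (rule prob_space_Lp_copula[OF p])
  show cube: "AE x in ?C. \<forall>i. x $ i \<in> {0..1}" by (rule AE_Lp_copula_cube[OF p(1)])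
  fix i :: 'n
  \<comment> \<open>Both laws live on [0,1] and have k-th moment 1/(k+1), so they coincide and the
    marginal density need not be integrated out.\<close>
  show "distr ?C borel (\<lambda>x. x $ i) = uniform_measure lborel {0<..<1}"
  proof (rule bounded_nn_moments_unique[where K = 1])
    show "prob_space (distr ?C borel (\<lambda>x. x $ i))"
      by (rule prob_space.prob_space_distr[OF C]) simp
    show "prob_space (uniform_measure lborel {0<..<1::real})"
      by (rule prob_space_uniform_measure) auto
    show "AE x in distr ?C borel (\<lambda>x. x $ i). 0 \<le> x \<and> x \<le> 1"
      using cube by (subst AE_distr_iff) (auto elim: eventually_mono)
    show "AE x in uniform_measure lborel {0<..<1::real}. 0 \<le> x \<and> x \<le> 1"
      by (rule AE_uniform_measureI) auto
    fix k
    have "(\<integral>\<^sup>+t. ennreal (t ^ k) \<partial>distr ?C borel (\<lambda>x. x $ i)) = (\<integral>\<^sup>+x. ennreal ((x $ i) ^ k) \<partial>?C)"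
      by (rule nn_integral_distr) simp_all
    then show "(\<integral>\<^sup>+t. ennreal (t ^ k) \<partial>distr ?C borel (\<lambda>x. x $ i)) =
        (\<integral>\<^sup>+t. ennreal (t ^ k) \<partial>uniform_measure lborel {0<..<1})"
      by (simp add: Lp_copula_moment[OF p] nn_integral_power_uniform_01)
  qed simp_all
qed simp

lemma positive_Lp_spherical_Lp_copula:
  assumes p: "p > 0" "p > real CARD('n::finite) - 1"
  shows "positive_Lp_spherical p (Lp_copula p :: (real ^ 'n) measure)"
proof -
  let ?C = "Lp_copula p :: (real ^ 'n) measure"
  let ?U = "Lp_uniform_pos p :: (real ^ 'n) measure"
  let ?T = "distr (lborel :: (real ^ 'n) measure) borel (Lp_norm p)"
  define \<rho> where "\<rho> = density ?T (\<lambda>r. Lp_copula_radial CARD('n) p (r powr p))"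
  have sets_\<rho> [simp, measurable_cong]: "sets \<rho> = sets borel" by (simp add: \<rho>_def)
  have C: "?C = distr (\<rho> \<Otimes>\<^sub>M ?U) borel (\<lambda>(r, u). r *\<^sub>R u)"
    unfolding \<rho>_def Lp_copula_def by (rule radial_mixture_eq_density[OF p(1), symmetric]) simp
  interpret U: prob_space ?U by (rule prob_space_Lp_uniform_pos[OF p(1)])
  have "prob_space \<rho>"
  proof
    \<comment> \<open>The radial law inherits its normalisation: the direction has total mass 1, so
      the mass of \<open>\<rho>\<close> is that of the copula, already known to be 1.\<close>
    have "1 = emeasure ?C UNIV"
      using prob_space.emeasure_space_1[OF prob_space_Lp_copula[OF p]] by simp
    also have "\<dots> = emeasure (\<rho> \<Otimes>\<^sub>M ?U) (space \<rho> \<times> space ?U)"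
      unfolding C by (subst emeasure_distr) (simp_all add: space_pair_measure)
    also have "\<dots> = emeasure \<rho> (space \<rho>) * emeasure ?U (space ?U)"
      by (rule U.emeasure_pair_measure_Times) (rule sets.top)+
    finally show "emeasure \<rho> (space \<rho>) = 1"
      using U.emeasure_space_1 by simp
  qed
  moreover have "AE r in \<rho>. 0 \<le> r"
    unfolding \<rho>_def by (simp add: AE_density AE_distr_iff)
  ultimately show ?thesis
    unfolding positive_Lp_spherical_def using C sets_\<rho> by blast
qed

theorem corollary11:
  fixes p :: real
  assumes "CARD('n::finite) \<ge> 2" and "p > 1" and "p > real CARD('n) - 1"
  shows "(\<exists>!C :: (real ^ 'n) measure. positive_Lp_spherical_copula p C) \<and>
    (\<forall>C :: (real ^ 'n) measure. positive_Lp_spherical_copula p C \<longrightarrow>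
       distributed C lborel (\<lambda>x. x) (\<lambda>x. ennreal
         (if (\<forall>i. 0 \<le> x $ i) \<and> Lp_norm p x < 1
          then 1 / (Gamma (1 + 1 / p) ^ (CARD('n) - 1) * Gamma (1 - (real CARD('n) - 1) / p)) *
               (1 - Lp_norm p x powr p) powr (- (real CARD('n) - 1) / p)
          else 0)))"
proof -
  have p: "p > 0" using assms by simp
  let ?C = "Lp_copula p :: (real ^ 'n) measure"
  let ?D = "\<lambda>x :: real ^ 'n. ennreal
         (if (\<forall>i. 0 \<le> x $ i) \<and> Lp_norm p x < 1
          then 1 / (Gamma (1 + 1 / p) ^ (CARD('n) - 1) * Gamma (1 - (real CARD('n) - 1) / p)) *
               (1 - Lp_norm p x powr p) powr (- (real CARD('n) - 1) / p)
          else 0)"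
  \<comment> \<open>The factor 2^n from folding cancels the 2^n in the denominator of
    \<open>Lp_copula_radial\<close>. The conditions on the norm and on its p-th power are equivalent
    since p > 0.\<close>
  have D: "2 ^ CARD('n) * indicator {x. \<forall>i. 0 \<le> x $ i} x *
      Lp_copula_radial CARD('n) p (Lp_norm p x powr p) = ?D x" for x
  proof (cases "\<forall>i. 0 \<le> x $ i")
    case True
    have lt: "Lp_norm p x powr p < 1 \<longleftrightarrow> Lp_norm p x < 1"
      using powr_le_iff[OF p, of 1 "Lp_norm p x"] by (simp flip: not_le)
    have "2 ^ CARD('n) * ennreal y = ennreal (2 ^ CARD('n) * y)" for y
      by (subst ennreal_mult') (simp_all flip: ennreal_power)
    with True show ?thesis
      unfolding Lp_copula_radial_def lt by simp
  qed auto
  have "?D \<in> borel_measurable borel"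
    by measurable
  then have dist: "distributed ?C lborel (\<lambda>x. x) ?D"
    unfolding distributed_def using distr_id2[of lborel ?C]
    by (simp add: Lp_copula_def D)
  have C: "positive_Lp_spherical_copula p ?C"
    unfolding positive_Lp_spherical_copula_def
    using copula_Lp_copula positive_Lp_spherical_Lp_copula p assms(3) by blast
  have unique: "C = ?C" if "positive_Lp_spherical_copula p C" for C
    by (rule positive_Lp_spherical_copula_unique[OF p that C])
  show ?thesis
  proof (intro conjI ex1I[of _ ?C] allI impI)
    fix C :: "(real ^ 'n) measure"
    assume "positive_Lp_spherical_copula p C"
    from unique[OF this] dist show "distributed C lborel (\<lambda>x. x) ?D" by (simp only:)
  qed (use C unique in blast)+
qed

end
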